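(* Let $\rho$ be a Borel probability measure on $\mathbb{R}$ having an exponential moment and a positive drift $\lambda=\int_{\mathbb{R}}y\,d\rho(y)>0$. Assume that there is $\gamma>0$ such that for every $f\in\mathcal{C}^\infty_c(\mathbb{R})$, $$(G-T_\lambda)\star f(x)\in\mathcal{O}\left(e^{-\gamma|x|}\right).$$ Then $\rho$ is $0$-weakly-diophantine.
   Context: $\rho$ has an exponential moment if $\int_{\mathbb{R}} e^{\eta|y|}\,d\rho(y)<+\infty$ for some $\eta>0$. $\widehat\rho(ib)=\int_{\mathbb{R}} e^{-iby}\,d\rho(y)$ for real $b$. $\rho$ is $0$-weakly-diophantine if $\liminf_{b\to\pm\infty}|1-\widehat\rho(ib)|>0$. $G=\sum_{n=0}^{+\infty}\tilde\rho^{\star n}$, where $\tilde\rho(A)=\int_{\mathbb{R}}\mathbf{1}_A(-y)\,d\rho(y)$, so that $G\star f(x)=\sum_{n\ge 0}\int_{\mathbb{R}} f(x+y)\,d\rho^{\star n}(y)$. $T_\lambda$ is the measure with density $\frac1\lambda\mathbf{1}_{\mathbb{R}_-}$ with respect to Lebesgue measure, so that $T_\lambda\star f(x)=\frac1\lambda\int_x^{+\infty}f(t)\,dt$. The $\mathcal{O}$ is as $x\to\pm\infty$, with constant allowed to depend on $f$. *)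

theory Defs
  imports "HOL-Probability.Probability" "HOL-Library.Landau_Symbols"
begin

definition has_exponential_moment :: "real measure \<Rightarrow> bool" where
  "has_exponential_moment \<rho> \<longleftrightarrow>
     (\<exists>\<eta>>0. (\<integral>\<^sup>+ y. ennreal (exp (\<eta> * \<bar>y\<bar>)) \<partial>\<rho>) < \<infinity>)"

text \<open>The bilateral Laplace transform; at \<^term>\<open>\<i> * of_real b\<close> the integrand is $e^{-iby}$.\<close>

definition laplace_hat :: "real measure \<Rightarrow> complex \<Rightarrow> complex" where
  "laplace_hat \<rho> z = (LINT y|\<rho>. exp (- z * of_real y))"

text \<open>The lower limit is taken in the extended reals; on the real line
  \<^const>\<open>at_infinity\<close> covers both ends.\<close>

definition weakly_diophantine_0 :: "real measure \<Rightarrow> bool" where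
  "weakly_diophantine_0 \<rho> \<longleftrightarrow>
     Liminf at_infinity (\<lambda>b::real. ereal (norm (1 - laplace_hat \<rho> (\<i> * of_real b)))) > 0"

definition reflected :: "real measure \<Rightarrow> real measure" where
  "reflected \<rho> = distr \<rho> borel uminus"

primrec conv_power :: "real measure \<Rightarrow> nat \<Rightarrow> real measure" where
  "conv_power \<rho> 0 = return borel 0"
| "conv_power \<rho> (Suc n) = (\<rho> \<star> conv_power \<rho> n)"

definition green_measure :: "real measure \<Rightarrow> real measure" where
  "green_measure \<rho> =
     measure_of UNIV (sets borel) (\<lambda>A. \<Sum>n. emeasure (conv_power (reflected \<rho>) n) A)"

definition T_measure :: "real \<Rightarrow> real measure" where
  "T_measure lam = density lborel (\<lambda>y. ennreal (1 / lam * indicator {..0} y))"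

definition conv_fun :: "real measure \<Rightarrow> (real \<Rightarrow> real) \<Rightarrow> real \<Rightarrow> real" where
  "conv_fun \<mu> f x = (LINT y|\<mu>. f (x - y))"

definition smooth_compact_support :: "(real \<Rightarrow> real) \<Rightarrow> bool" where
  "smooth_compact_support f \<longleftrightarrow>
     (\<forall>n. (deriv ^^ n) f differentiable_on UNIV) \<and> compact (closure {x. f x \<noteq> 0})"

lemma sets_conv_power [simp]: "sets (conv_power \<rho> n) = sets borel"
  by (cases n) simp_all

text \<open>The set function in the definition of \<^const>\<open>green_measure\<close> is a measure, so
  \<^const>\<open>measure_of\<close> does not fall back to the zero measure.\<close>

lemma sets_green_measure [simp]: "sets (green_measure \<rho>) = sets borel"
  unfolding green_measure_def by (metis sets.sets_measure_of_eq space_borel)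

lemma space_green_measure [simp]: "space (green_measure \<rho>) = UNIV"
  unfolding green_measure_def by (simp add: space_measure_of_conv)

lemma emeasure_green_measure:
  assumes A: "A \<in> sets borel"
  shows "emeasure (green_measure \<rho>) A = (\<Sum>n. emeasure (conv_power (reflected \<rho>) n) A)"
proof (rule emeasure_measure_of[OF green_measure_def])
  show "sets borel \<subseteq> Pow (UNIV :: real set)" by simp
  show "A \<in> sets (green_measure \<rho>)" using A by simp
  show "positive (sets (green_measure \<rho>)) (\<lambda>A. \<Sum>n. emeasure (conv_power (reflected \<rho>) n) A)"
    by (simp add: positive_def)
  show "countably_additive (sets (green_measure \<rho>))
      (\<lambda>A. \<Sum>n. emeasure (conv_power (reflected \<rho>) n) A)"
  proof (rule countably_additiveI)
    fix B :: "nat \<Rightarrow> real set"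
    assume B: "range B \<subseteq> sets (green_measure \<rho>)" "disjoint_family B"
    have "(\<Sum>i. \<Sum>n. emeasure (conv_power (reflected \<rho>) n) (B i)) =
        (\<Sum>n. \<Sum>i. emeasure (conv_power (reflected \<rho>) n) (B i))"
      unfolding nn_integral_count_space_nat[symmetric, of "\<lambda>i. \<Sum>n. emeasure (conv_power (reflected \<rho>) n) (B i)"]
      by (subst nn_integral_suminf) (simp_all add: nn_integral_count_space_nat)
    also have "\<dots> = (\<Sum>n. emeasure (conv_power (reflected \<rho>) n) (\<Union>i. B i))"
      using B by (intro suminf_cong suminf_emeasure) auto
    finally show "(\<Sum>i. \<Sum>n. emeasure (conv_power (reflected \<rho>) n) (B i)) =
        (\<Sum>n. emeasure (conv_power (reflected \<rho>) n) (\<Union>(range B)))" .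
  qed
qed

end

theory Submission
  imports Defs "HOL-Complex_Analysis.Complex_Analysis"
begin

text \<open>If the error term decays exponentially, then \<open>laplace_hat \<rho> z \<noteq> 1\<close> for every \<open>z \<noteq> 0\<close> in a strip
  \<open>\<bar>Re z\<bar> < \<delta>\<close>. Indeed, for a derivative \<open>f = g'\<close> the function \<open>T * f\<close> has compact support, so
  \<open>u = G * f\<close> itself decays exponentially, and it solves \<open>u - P u = f\<close> with
  \<open>P u x = \<integral> u (x + y) d\<rho>(y)\<close>. If \<open>laplace_hat \<rho> z = 1\<close>, multiplying by \<open>exp (z x)\<close> and
  integrating gives \<open>0 = \<integral> exp (z x) f(x) dx = - z \<integral> exp (z x) g(x) dx\<close>, which fails when
  \<open>g\<close> is a bump on a short interval.

  If on the other hand \<open>laplace_hat \<rho> (\<i> b\<^sub>n) \<longlonglongrightarrow> 1\<close> with \<open>\<bar>b\<^sub>n\<bar>\<close> bounded away from \<open>0\<close>, then, since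
  \<open>\<bar>1 - exp (\<i> t)\<bar>\<^sup>2 = 2 Re (1 - exp (\<i> t))\<close>, the Cauchy-Schwarz inequality shows
  \<open>laplace_hat \<rho> (\<i> b\<^sub>n + z) \<longlonglongrightarrow> laplace_hat \<rho> z\<close> uniformly near \<open>0\<close>. The limit takes the value \<open>1\<close> at
  \<open>0\<close> without being constant, so Hurwitz' theorem produces a forbidden zero of
  \<open>1 - laplace_hat \<rho>\<close> near some \<open>\<i> b\<^sub>n\<close>.\<close>

subsection \<open>Smooth functions with compact support\<close>

text \<open>A polynomial factor in \<open>1 / x\<close> makes the family closed under
  differentiation; \<open>p = 1\<close> is the classical function that is flat at 0.\<close>

definition exp_flat :: "real poly \<Rightarrow> real \<Rightarrow> real" where
  "exp_flat p x = (if x \<le> 0 then 0 else poly p (1 / x) * exp (- (1 / x)))"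

lemma poly_times_exp_minus_tendsto_0:
  fixes p :: "real poly"
  shows "((\<lambda>t. poly p t * exp (- t)) \<longlongrightarrow> 0) at_top"
proof -
  have "((\<lambda>t. \<Sum>i\<le>degree p. coeff p i * (t ^ i / exp t)) \<longlongrightarrow> (\<Sum>i\<le>degree p. coeff p i * 0)) at_top"
    by (intro tendsto_intros tendsto_power_div_exp_0)
  moreover have "(\<lambda>t. poly p t * exp (- t)) = (\<lambda>t. \<Sum>i\<le>degree p. coeff p i * (t ^ i / exp t))"
    by (auto simp: poly_altdef exp_minus sum_distrib_right divide_inverse mult.assoc)
  ultimately show ?thesis by simp
qed

lemma exp_flat_has_derivative:
  "(exp_flat p has_real_derivative exp_flat ([:0, 0, 1:] * (p - pderiv p)) x) (at x)"
proof -
  let ?q = "[:0, 0, 1:] * (p - pderiv p)"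
  consider "x < 0" | "x > 0" | "x = 0" by linarith
  then show ?thesis
  proof cases
    case 1
    have "((\<lambda>_. 0) has_real_derivative exp_flat ?q x) (at x)"
      using 1 by (simp add: exp_flat_def)
    then show ?thesis
      by (rule has_field_derivative_transform_within_open[where S="{..<0}"])
        (use 1 in \<open>auto simp: exp_flat_def\<close>)
  next
    case 2
    have "((\<lambda>x. poly p (1 / x) * exp (- (1 / x))) has_real_derivative exp_flat ?q x) (at x)"
      using 2 by (auto intro!: derivative_eq_intros DERIV_chain'[OF _ poly_DERIV]
        simp: exp_flat_def field_simps power2_eq_square)
    then show ?thesis
      by (rule has_field_derivative_transform_within_open[where S="{0<..}"])
        (use 2 in \<open>auto simp: exp_flat_def\<close>)
  next
    case 3
    \<comment> \<open>With \<open>t = 1 / h\<close> the difference quotient at 0 is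
      \<open>t * poly p t * exp (- t)\<close>, which explains the extra factor
      \<open>[:0, 1:]\<close>.\<close>
    have "((\<lambda>h. poly ([:0, 1:] * p) (1 / h) * exp (- (1 / h))) \<longlongrightarrow> 0) (at_right 0)"
      by (rule filterlim_compose[OF poly_times_exp_minus_tendsto_0[of "[:0, 1:] * p"]])
        (simp add: divide_inverse filterlim_inverse_at_top_right)
    then have "((\<lambda>h. exp_flat p h / h) \<longlongrightarrow> 0) (at_right 0)"
      by (rule tendsto_cong[THEN iffD1, rotated])
        (auto simp: eventually_at_filter exp_flat_def)
    moreover have "((\<lambda>h. exp_flat p h / h) \<longlongrightarrow> 0) (at_left 0)"
      by (rule tendsto_eventually) (auto simp: eventually_at_filter exp_flat_def)
    ultimately have "((\<lambda>h. exp_flat p h / h) \<longlongrightarrow> 0) (at 0)"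
      by (simp add: filterlim_split_at)
    then show ?thesis
      unfolding 3 DERIV_def by (simp add: exp_flat_def)
  qed
qed

text \<open>The product rule turns one product into a sum of two, so closing under sums gives a
  class stable under differentiation. All its members are therefore smooth.\<close>

inductive_set flat_products :: "real \<Rightarrow> (real \<Rightarrow> real) set" for a where
  prod: "(\<lambda>x. exp_flat p (a + x) * exp_flat q (a - x)) \<in> flat_products a"
| add: "f \<in> flat_products a \<Longrightarrow> g \<in> flat_products a \<Longrightarrow> (\<lambda>x. f x + g x) \<in> flat_products a"

lemma flat_products_derivative:
  assumes "f \<in> flat_products a"
  shows "\<exists>f'\<in>flat_products a. \<forall>x. (f has_real_derivative f' x) (at x)"
  using assms
proof induction
  case (prod p q)
  let ?d = "\<lambda>p. [:0, 0, 1:] * (p - pderiv p) :: real poly"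
  have "((\<lambda>x. exp_flat p (a + x) * exp_flat q (a - x)) has_real_derivative
      exp_flat (?d p) (a + x) * exp_flat q (a - x) + exp_flat p (a + x) * exp_flat (- ?d q) (a - x)) (at x)" for x
  proof -
    have 1: "((\<lambda>x. exp_flat p (a + x)) has_real_derivative exp_flat (?d p) (a + x)) (at x)"
      by (rule DERIV_chain'[OF _ exp_flat_has_derivative, THEN DERIV_cong])
        (auto intro!: derivative_eq_intros)
    \<comment> \<open>The sign produced by the reflection \<open>a - x\<close> is absorbed into the
      polynomial.\<close>
    have 2: "((\<lambda>x. exp_flat q (a - x)) has_real_derivative exp_flat (- ?d q) (a - x)) (at x)"
      by (rule DERIV_chain'[OF _ exp_flat_has_derivative, THEN DERIV_cong])
        (auto intro!: derivative_eq_intros simp: exp_flat_def algebra_simps)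
    show ?thesis
      by (rule DERIV_cong[OF DERIV_mult[OF 1 2]]) simp
  qed
  then show ?case
    by (intro bexI[of _ "\<lambda>x. exp_flat (?d p) (a + x) * exp_flat q (a - x) + exp_flat p (a + x) * exp_flat (- ?d q) (a - x)"]
        flat_products.intros) blast
next
  case (add f g)
  then obtain f' g' where "f' \<in> flat_products a" "g' \<in> flat_products a"
    "\<forall>x. (f has_real_derivative f' x) (at x)" "\<forall>x. (g has_real_derivative g' x) (at x)" by blast
  then show ?case
    by (intro bexI[of _ "\<lambda>x. f' x + g' x"] flat_products.add) (auto intro: DERIV_add)
qed

lemma flat_products_smooth:
  "f \<in> flat_products a \<Longrightarrow> (deriv ^^ n) f differentiable_on UNIV"
proof (induction n arbitrary: f)
  case 0
  then show ?case
    using flat_products_derivative[of f a]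
    by (auto simp: differentiable_on_def real_differentiable_def)
next
  case (Suc n)
  obtain f' where f': "f' \<in> flat_products a" "\<forall>x. (f has_real_derivative f' x) (at x)"
    using flat_products_derivative[OF Suc.prems] by blast
  then have "deriv f = f'" by (auto intro: DERIV_imp_deriv)
  with Suc.IH[OF f'(1)] show ?case by (simp add: funpow_swap1)
qed

lemma exists_bump:
  fixes a :: real
  assumes "a > 0"
  obtains g where "smooth_compact_support g" "\<And>x. g x \<ge> 0" "\<And>x. g x > 0 \<longleftrightarrow> \<bar>x\<bar> < a"
proof
  let ?g = "\<lambda>x. exp_flat 1 (a + x) * exp_flat 1 (a - x)"
  show pos: "?g x > 0 \<longleftrightarrow> \<bar>x\<bar> < a" for x by (auto simp: exp_flat_def)
  show nonneg: "?g x \<ge> 0" for x by (auto simp: exp_flat_def)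
  have "{x. ?g x \<noteq> 0} = {-a<..<a}"
  proof (rule set_eqI)
    fix x
    show "x \<in> {x. ?g x \<noteq> 0} \<longleftrightarrow> x \<in> {-a<..<a}"
      using pos[of x] nonneg[of x] by (auto simp del: mult_eq_0_iff)
  qed
  then show "smooth_compact_support ?g"
    using assms flat_products_smooth[OF flat_products.prod, of _ 1 a 1]
    unfolding smooth_compact_support_def by (simp del: mult_eq_0_iff)
qed

lemma smooth_compact_support_has_deriv:
  "smooth_compact_support g \<Longrightarrow> (g has_real_derivative deriv g x) (at x)"
  unfolding smooth_compact_support_def
  by (auto dest: spec[of _ 0] simp: differentiable_on_def DERIV_deriv_iff_real_differentiable)

lemma smooth_compact_support_deriv:
  assumes "smooth_compact_support g"
  shows "smooth_compact_support (deriv g)"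
proof -
  have 1: "(deriv ^^ n) (deriv g) differentiable_on UNIV" for n
    using assms unfolding smooth_compact_support_def
    by (auto dest: spec[of _ "Suc n"] simp: funpow_swap1)
  \<comment> \<open>Off the closed support, \<open>g\<close> vanishes on a whole neighbourhood of
    \<open>x\<close>, hence so does its derivative.\<close>
  have "deriv g x = 0" if x: "x \<notin> closure {x. g x \<noteq> 0}" for x
  proof (rule DERIV_imp_deriv)
    have "((\<lambda>_. 0) has_real_derivative 0) (at x)" by simp
    then show "(g has_real_derivative 0) (at x)"
      by (rule has_field_derivative_transform_within_open[where S="- closure {x. g x \<noteq> 0}"])
        (use x closure_subset[of "{x. g x \<noteq> 0}"] in auto)
  qed
  then have "closure {x. deriv g x \<noteq> 0} \<subseteq> closure {x. g x \<noteq> 0}"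
    by (intro closure_minimal) auto
  moreover have "compact (closure {x. g x \<noteq> 0})"
    using assms unfolding smooth_compact_support_def by blast
  ultimately have "compact (closure {x. deriv g x \<noteq> 0})"
    using compact_Int_closed[OF _ closed_closure] by (metis inf.absorb_iff2)
  with 1 show ?thesis
    unfolding smooth_compact_support_def by blast
qed

lemma smooth_compact_support_continuous:
  "smooth_compact_support g \<Longrightarrow> continuous_on UNIV g"
  by (meson continuous_at_imp_continuous_on DERIV_isCont smooth_compact_support_has_deriv)

lemma smooth_compact_support_bounded_support:
  assumes "smooth_compact_support g"
  obtains b where "b > 0" "\<And>x. \<bar>x\<bar> \<ge> b \<Longrightarrow> g x = 0"
proof -
  have "bounded (closure {x. g x \<noteq> 0})"
    using assms compact_imp_bounded unfolding smooth_compact_support_def by blast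
  then obtain b where b: "b > 0" "\<forall>x\<in>closure {x. g x \<noteq> 0}. norm x \<le> b"
    by (auto simp: bounded_pos)
  show ?thesis
  proof (rule that[of "b + 1"])
    show "b + 1 > 0" using b by simp
    show "g x = 0" if "\<bar>x\<bar> \<ge> b + 1" for x
      using b(2) that closure_subset[of "{x. g x \<noteq> 0}"] by force
  qed
qed

subsection \<open>The Green measure\<close>

text \<open>Induction over nonnegative measurable functions. The analytic content is the last case:
  monotone convergence is applied under \<open>N\<close> and under each \<open>M n\<close>, and the
  supremum passes through the series because the integrals increase.\<close>

lemma nn_integral_suminf_measure:
  fixes M :: "nat \<Rightarrow> 'a measure"
  assumes sets: "\<And>n. sets (M n) = sets N"
    and emeasure: "\<And>A. A \<in> sets N \<Longrightarrow> emeasure N A = (\<Sum>n. emeasure (M n) A)"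
    and f: "f \<in> borel_measurable N"
  shows "(\<integral>\<^sup>+x. f x \<partial>N) = (\<Sum>n. \<integral>\<^sup>+x. f x \<partial>M n)"
  using f
proof (induction rule: borel_measurable_induct)
  have space: "space (M n) = space N" for n
    by (rule sets_eq_imp_space_eq[OF sets])
  have meas: "g \<in> borel_measurable (M n)" if "g \<in> borel_measurable N" for g :: "'a \<Rightarrow> ennreal" and n
    using that by (simp add: measurable_cong_sets[OF sets refl])
  {
    case (cong f g)
    have "(\<integral>\<^sup>+x. f x \<partial>N) = (\<integral>\<^sup>+x. g x \<partial>N)" "(\<integral>\<^sup>+x. f x \<partial>M n) = (\<integral>\<^sup>+x. g x \<partial>M n)" for n
      using cong(3) by (auto intro!: nn_integral_cong simp: space)
    with cong(4) show ?case by simp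
  next
    case (set A)
    then show ?case by (simp add: emeasure sets)
  next
    case (mult u c)
    then show ?case by (simp add: nn_integral_cmult meas)
  next
    case (add u v)
    then show ?case by (simp add: nn_integral_add meas suminf_add)
  next
    case (seq U)
    have *: "(\<integral>\<^sup>+x. (SUP i. U i) x \<partial>L) = (SUP i. \<integral>\<^sup>+x. U i x \<partial>L)"
      if "\<And>i. U i \<in> borel_measurable L" for L
      using nn_integral_monotone_convergence_SUP[OF \<open>incseq U\<close> that] by (simp add: image_comp)
    have "(\<integral>\<^sup>+x. (SUP i. U i) x \<partial>N) = (SUP i. \<Sum>n. \<integral>\<^sup>+x. U i x \<partial>M n)"
      by (subst *) (simp_all add: seq)
    also have "\<dots> = (\<Sum>n. SUP i. \<integral>\<^sup>+x. U i x \<partial>M n)"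
      using \<open>incseq U\<close>
      by (intro ennreal_suminf_SUP_eq[symmetric]) (auto simp: incseq_def le_fun_def intro!: nn_integral_mono)
    also have "\<dots> = (\<Sum>n. \<integral>\<^sup>+x. (SUP i. U i) x \<partial>M n)"
      by (subst *) (simp_all add: seq meas)
    finally show ?case .
  }
qed

lemma sums_integral_suminf_measure:
  fixes M :: "nat \<Rightarrow> 'a measure" and f :: "'a \<Rightarrow> real"
  assumes sets: "\<And>n. sets (M n) = sets N"
    and emeasure: "\<And>A. A \<in> sets N \<Longrightarrow> emeasure N A = (\<Sum>n. emeasure (M n) A)"
    and f: "integrable N f"
  shows "(\<lambda>n. LINT x|M n. f x) sums (LINT x|N. f x)"
proof -
  have pos: "integrable (M n) g \<and> (\<lambda>n. LINT x|M n. g x) sums (LINT x|N. g x)"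
    if g: "integrable N g" "\<And>x. g x \<ge> 0" for g :: "'a \<Rightarrow> real" and n
  proof -
    have meas: "g \<in> borel_measurable (M n)" for n
      using g(1) by (simp add: measurable_cong_sets[OF sets refl])
    have eq: "(\<Sum>n. \<integral>\<^sup>+x. ennreal (g x) \<partial>M n) = ennreal (LINT x|N. g x)"
      using g nn_integral_suminf_measure[of M N "\<lambda>x. ennreal (g x)", OF sets emeasure]
      by (simp add: nn_integral_eq_integral)
    have int: "integrable (M n) g" for n
    proof (rule integrableI_nonneg[OF meas])
      \<comment> \<open>Integrability under each \<open>M n\<close> holds because its integral is
        one term of a nonnegative series with finite sum.\<close>
      have "(\<integral>\<^sup>+x. ennreal (g x) \<partial>M n) \<le> (\<Sum>n. \<integral>\<^sup>+x. ennreal (g x) \<partial>M n)"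
        using sum_le_suminf[of "\<lambda>n. \<integral>\<^sup>+x. ennreal (g x) \<partial>M n" "{n}"] by simp
      then show "(\<integral>\<^sup>+x. ennreal (g x) \<partial>M n) < \<infinity>"
        unfolding eq by (simp add: order_le_less_trans)
    qed (simp add: g)
    have "(\<lambda>n. ennreal (LINT x|M n. g x)) sums ennreal (LINT x|N. g x)"
      using eq int g(2) by (simp add: nn_integral_eq_integral sums_iff)
    then have "(\<lambda>n. LINT x|M n. g x) sums (LINT x|N. g x)"
      using g(2) by (subst (asm) sums_ennreal) (auto intro: Bochner_Integration.integral_nonneg)
    with int show ?thesis by blast
  qed
  have f1: "integrable N (\<lambda>x. max 0 (f x))" and f2: "integrable N (\<lambda>x. max 0 (- f x))"
    using f by auto
  have split: "(LINT x|L. f x) = (LINT x|L. max 0 (f x)) - (LINT x|L. max 0 (- f x))"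
    if "integrable L (\<lambda>x. max 0 (f x))" "integrable L (\<lambda>x. max 0 (- f x))" for L
  proof -
    have "(LINT x|L. f x) = (LINT x|L. max 0 (f x) - max 0 (- f x))"
      by (rule Bochner_Integration.integral_cong) auto
    then show ?thesis using that by simp
  qed
  show ?thesis
    using pos[OF f1] pos[OF f2] f1 f2 by (simp add: split sums_diff)
qed

section \<open>Convolution powers and the renewal equation\<close>

lemma real_distribution_reflected:
  assumes "real_distribution \<rho>"
  shows "real_distribution (reflected \<rho>)"
proof -
  interpret real_distribution \<rho> by fact
  show ?thesis unfolding reflected_def by simp
qed

lemma real_distribution_conv_power:
  assumes "real_distribution \<rho>"
  shows "real_distribution (conv_power \<rho> n)"
proof (induction n)
  case 0
  show ?case
    by (auto simp: real_distribution_def real_distribution_axioms_def intro!: prob_space_return)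
next
  case (Suc n)
  interpret real_distribution \<rho> by fact
  interpret N: real_distribution "conv_power \<rho> n" by fact
  interpret pair_prob_space \<rho> "conv_power \<rho> n" ..
  show ?case
    unfolding conv_power.simps convolution_def by (intro P.real_distribution_distr) measurable
qed

lemma integral_conv_power_Suc:
  fixes f :: "real \<Rightarrow> real"
  assumes "real_distribution \<rho>" and f: "integrable (conv_power \<rho> (Suc n)) f"
  shows "(LINT x|conv_power \<rho> (Suc n). f x) = (LINT x|\<rho>. LINT y|conv_power \<rho> n. f (x + y))"
proof -
  interpret real_distribution \<rho> by fact
  interpret N: real_distribution "conv_power \<rho> n"
    by (rule real_distribution_conv_power) fact
  interpret pair_prob_space \<rho> "conv_power \<rho> n" ..
  have f_borel [measurable]: "f \<in> borel_measurable borel"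
    using borel_measurable_integrable[OF f] by simp
  have "integrable (\<rho> \<Otimes>\<^sub>M conv_power \<rho> n) (\<lambda>z. f (fst z + snd z))"
    using f by (simp add: convolution_def case_prod_beta' integrable_distr_eq)
  from integral_fst'[OF this] show ?thesis
    by (simp add: convolution_def case_prod_beta' integral_distr)
qed

text \<open>The exponential turns sums into products, so exponential moments multiply under
  convolution. Working first with nonnegative integrals yields integrability and the value
  together.\<close>

lemma integral_exp_conv_power:
  assumes "real_distribution \<rho>" and "integrable \<rho> (\<lambda>y. exp (s * y))"
  shows "integrable (conv_power \<rho> n) (\<lambda>y. exp (s * y))"
    and "(LINT y|conv_power \<rho> n. exp (s * y)) = (LINT y|\<rho>. exp (s * y)) ^ n"
proof -
  interpret real_distribution \<rho> by fact
  let ?r = "LINT y|\<rho>. exp (s * y)"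
  have r: "?r \<ge> 0" by (rule Bochner_Integration.integral_nonneg) simp
  have *: "(\<integral>\<^sup>+y. ennreal (exp (s * y)) \<partial>conv_power \<rho> n) = ennreal (?r ^ n)"
  proof (induction n)
    case 0
    show ?case by (simp add: nn_integral_return)
  next
    case (Suc n)
    interpret N: real_distribution "conv_power \<rho> n"
      by (rule real_distribution_conv_power) fact
    have "(\<integral>\<^sup>+y. ennreal (exp (s * y)) \<partial>conv_power \<rho> (Suc n)) =
        (\<integral>\<^sup>+x. \<integral>\<^sup>+y. ennreal (exp (s * x)) * ennreal (exp (s * y)) \<partial>conv_power \<rho> n \<partial>\<rho>)"
      unfolding conv_power.simps
      by (subst nn_integral_convolution)
        (auto intro: finite_measure_axioms N.finite_measure_axioms simp: ennreal_mult distrib_left exp_add)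
    also have "\<dots> = ennreal ?r * ennreal (?r ^ n)"
      using assms(2) by (simp add: nn_integral_cmult nn_integral_multc Suc nn_integral_eq_integral)
    finally show ?case using r by (simp add: ennreal_mult)
  qed
  show int: "integrable (conv_power \<rho> n) (\<lambda>y. exp (s * y))"
    by (rule integrableI_nonneg) (auto simp: * measurable_cong_sets[OF sets_conv_power refl])
  show "(LINT y|conv_power \<rho> n. exp (s * y)) = ?r ^ n"
    using * r int by (subst integral_eq_nn_integral) auto
qed

text \<open>Relative to the weight \<open>exp (- s * x)\<close>, averaging over one step of the walk
  contracts by the factor \<open>r < 1\<close>, the integral of \<open>exp (- s * y)\<close>. The
  series for \<open>G * f\<close> is thus dominated by a geometric one, and the renewal equation is
  a shift of its index.\<close>

lemma conv_fun_green_measure: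
  fixes f :: "real \<Rightarrow> real"
  assumes \<rho>: "real_distribution \<rho>"
    and int: "integrable \<rho> (\<lambda>y. exp (- s * y))"
    and less_1: "(LINT y|\<rho>. exp (- s * y)) < 1"
    and f [measurable]: "f \<in> borel_measurable borel"
    and bound: "\<And>x. \<bar>f x\<bar> \<le> C * exp (- s * x)"
  shows "conv_fun (green_measure \<rho>) f \<in> borel_measurable borel" (is ?meas)
    and "\<exists>K. \<forall>x. \<bar>conv_fun (green_measure \<rho>) f x\<bar> \<le> K * exp (- s * x)" (is ?bound)
    and "conv_fun (green_measure \<rho>) f x = f x + (LINT y|\<rho>. conv_fun (green_measure \<rho>) f (x + y))" (is ?eq)
proof -
  interpret real_distribution \<rho> by fact
  define r where "r = (LINT y|\<rho>. exp (- s * y))"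
  define \<mu> where "\<mu> = conv_power (reflected \<rho>)"
  \<comment> \<open>\<open>u n\<close> is the \<open>n\<close>-th iterate on \<open>f\<close> of the
    operator averaging \<open>f (x + y)\<close> over \<open>\<rho>\<close>: the reflection in
    \<open>\<mu> n\<close> cancels the minus sign in \<open>x - y\<close>.\<close>
  define u where "u n x = (LINT y|\<mu> n. f (x - y))" for n x
  let ?u = "conv_fun (green_measure \<rho>) f"
  have r: "0 \<le> r" "r < 1"
    using less_1 by (auto simp: r_def)
  have C: "C \<ge> 0" using bound[of 0] by simp
  have rd: "real_distribution (\<mu> n)" for n
    unfolding \<mu>_def using \<rho> by (intro real_distribution_conv_power real_distribution_reflected)
  have sets_\<mu> [measurable_cong, simp]: "sets (\<mu> n) = sets borel" for n by (simp add: \<mu>_def)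
  note sets_green_measure [measurable_cong]
  have "integrable (reflected \<rho>) (\<lambda>y. exp (s * y))" "(LINT y|reflected \<rho>. exp (s * y)) = r"
    using int by (simp_all add: reflected_def integrable_distr_eq integral_distr r_def)
  then have exp: "integrable (\<mu> n) (\<lambda>y. exp (s * y))" "(LINT y|\<mu> n. exp (s * y)) = r ^ n" for n
    unfolding \<mu>_def using integral_exp_conv_power[OF real_distribution_reflected[OF \<rho>], of s n] by auto
  have f_le: "\<bar>f (x - y)\<bar> \<le> C * exp (- s * x) * exp (s * y)" for x y
    using bound[of "x - y"] by (simp add: mult.assoc exp_add[symmetric] algebra_simps)
  have u_int: "integrable (\<mu> n) (\<lambda>y. f (x - y))" for n x
  proof (rule Bochner_Integration.integrable_bound)
    show "integrable (\<mu> n) (\<lambda>y. C * exp (- s * x) * exp (s * y))" using exp by simp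
    show "AE y in \<mu> n. norm (f (x - y)) \<le> norm (C * exp (- s * x) * exp (s * y))"
      using f_le[of x] C by (simp add: abs_mult)
  qed measurable
  have u_abs: "(LINT y|\<mu> n. \<bar>f (x - y)\<bar>) \<le> C * exp (- s * x) * r ^ n" for n x
  proof -
    have "(LINT y|\<mu> n. \<bar>f (x - y)\<bar>) \<le> (LINT y|\<mu> n. C * exp (- s * x) * exp (s * y))"
      using u_int exp f_le by (intro integral_mono) auto
    then show ?thesis by (simp add: exp)
  qed
  have u_le: "\<bar>u n x\<bar> \<le> C * exp (- s * x) * r ^ n" for n x
    unfolding u_def by (rule order_trans[OF integral_abs_bound u_abs])
  have geo: "(\<lambda>n. C * exp (- s * x) * r ^ n) sums (C * exp (- s * x) * (1 / (1 - r)))" for x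
    using r by (intro sums_mult geometric_sums) simp
  \<comment> \<open>The Green measure has infinite total mass, so integrability has to come from the
    geometric bound on the separate terms.\<close>
  have green_int: "integrable (green_measure \<rho>) (\<lambda>y. f (x - y))" for x
  proof (rule integrableI_bounded)
    have "(\<integral>\<^sup>+y. ennreal (norm (f (x - y))) \<partial>green_measure \<rho>) =
        (\<Sum>n. \<integral>\<^sup>+y. ennreal (norm (f (x - y))) \<partial>\<mu> n)"
      by (rule nn_integral_suminf_measure) (auto simp: emeasure_green_measure \<mu>_def)
    also have "\<dots> = (\<Sum>n. ennreal (LINT y|\<mu> n. \<bar>f (x - y)\<bar>))"
      using u_int by (subst nn_integral_eq_integral) auto
    also have "\<dots> \<le> (\<Sum>n. ennreal (C * exp (- s * x) * r ^ n))"
      by (intro suminf_le ennreal_leI u_abs) auto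
    also have "\<dots> = ennreal (C * exp (- s * x) * (1 / (1 - r)))"
      using C r by (intro suminf_ennreal_eq[OF _ geo]) auto
    finally show "(\<integral>\<^sup>+y. ennreal (norm (f (x - y))) \<partial>green_measure \<rho>) < \<infinity>"
      by (simp add: order_le_less_trans)
  qed measurable
  have u_sums: "(\<lambda>n. u n x) sums ?u x" for x
    unfolding u_def conv_fun_def
    by (rule sums_integral_suminf_measure) (auto simp: emeasure_green_measure \<mu>_def green_int)
  have u_meas [measurable]: "u n \<in> borel_measurable borel" for n
  proof -
    interpret N: real_distribution "\<mu> n" by (rule rd)
    show ?thesis unfolding u_def by (rule N.borel_measurable_lebesgue_integral) measurable
  qed
  have u_eq: "?u = (\<lambda>x. \<Sum>n. u n x)"
    using u_sums by (auto simp: sums_iff)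
  show ?meas unfolding u_eq by measurable
  have "\<bar>?u x\<bar> \<le> C / (1 - r) * exp (- s * x)" for x
  proof -
    have "\<bar>\<Sum>n. u n x\<bar> \<le> (\<Sum>n. C * exp (- s * x) * r ^ n)"
      using u_le geo[of x] norm_suminf_le[of "\<lambda>n. u n x" "\<lambda>n. C * exp (- s * x) * r ^ n"]
      by (auto simp: sums_iff)
    then show ?thesis using geo[of x] by (simp add: u_eq sums_iff mult_ac)
  qed
  then show ?bound by blast
  have u_Suc: "(LINT y|\<rho>. u n (x + y)) = u (Suc n) x" for n
  proof -
    have "u (Suc n) x = (LINT y|reflected \<rho>. LINT w|\<mu> n. f (x - (y + w)))"
      using integral_conv_power_Suc[OF real_distribution_reflected[OF \<rho>], of n "\<lambda>y. f (x - y)"]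
        u_int[of "Suc n" x]
      by (simp add: u_def \<mu>_def)
    also have "\<dots> = (LINT y|reflected \<rho>. u n (x - y))"
      by (simp add: u_def diff_diff_eq)
    also have "\<dots> = (LINT y|\<rho>. u n (x + y))"
      unfolding reflected_def by (subst integral_distr) auto
    finally show ?thesis by simp
  qed
  have e: "exp (- s * (x + y)) = exp (- s * x) * exp (- s * y)" for y
    by (simp add: algebra_simps exp_add[symmetric] exp_diff)
  have u_le': "\<bar>u n (x + y)\<bar> \<le> C * exp (- s * x) * r ^ n * exp (- s * y)" for n y
    using u_le[of n "x + y"] unfolding e by (simp only: ac_simps)
  have u_int_\<rho>: "integrable \<rho> (\<lambda>y. u n (x + y))" for n
  proof (rule Bochner_Integration.integrable_bound)
    show "integrable \<rho> (\<lambda>y. C * exp (- s * x) * r ^ n * exp (- s * y))" using int by simp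
    show "AE y in \<rho>. norm (u n (x + y)) \<le> norm (C * exp (- s * x) * r ^ n * exp (- s * y))"
      using u_le'[of n] C r by (simp add: abs_mult)
  qed measurable
  have "(\<lambda>n. LINT y|\<rho>. u n (x + y)) sums (LINT y|\<rho>. (\<Sum>n. u n (x + y)))"
  proof (rule sums_integral[OF u_int_\<rho>])
    have "summable (\<lambda>n. norm (u n y))" for y
      by (rule summable_comparison_test'[OF sums_summable[OF geo[of y]], of 0])
        (use u_le in simp)
    then show "AE y in \<rho>. summable (\<lambda>n. norm (u n (x + y)))" by simp
    show "summable (\<lambda>n. LINT y|\<rho>. norm (u n (x + y)))"
    proof (rule summable_comparison_test')
      \<comment> \<open>The extra factor \<open>r\<close> comes from integrating
        \<open>exp (- s * y)\<close> against \<open>\<rho>\<close>.\<close>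
      show "summable (\<lambda>n. C * exp (- s * x) * r * r ^ n)"
        using r by (intro summable_mult summable_geometric) simp
      show "norm (LINT y|\<rho>. norm (u n (x + y))) \<le> C * exp (- s * x) * r * r ^ n" for n
      proof -
        have "(LINT y|\<rho>. norm (u n (x + y))) \<le> (LINT y|\<rho>. C * exp (- s * x) * r ^ n * exp (- s * y))"
          using u_int_\<rho> int u_le'[of n] by (intro integral_mono) auto
        then show ?thesis by (simp add: r_def mult_ac)
      qed
    qed
  qed
  then have "(\<lambda>n. u (Suc n) x) sums (LINT y|\<rho>. ?u (x + y))"
    by (simp add: u_Suc u_eq)
  moreover have "u 0 x = f x"
    by (simp add: u_def \<mu>_def integral_return)
  ultimately have "(\<lambda>n. u n x) sums ((LINT y|\<rho>. ?u (x + y)) + f x)"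
    using sums_Suc[of "\<lambda>n. u n x"] by simp
  from sums_unique2[OF u_sums this] show ?eq by simp
qed

subsection \<open>Exponential transforms\<close>

lemma (in real_distribution) prob_UNIV [simp]: "prob UNIV = 1"
  using prob_space by simp

lemma (in real_distribution) has_exponential_momentE:
  assumes "has_exponential_moment M"
  obtains \<eta> where "\<eta> > 0" "integrable M (\<lambda>y. exp (\<eta> * \<bar>y\<bar>))"
proof -
  obtain \<eta> where \<eta>: "\<eta> > 0" "(\<integral>\<^sup>+y. ennreal (exp (\<eta> * \<bar>y\<bar>)) \<partial>M) < \<infinity>"
    using assms unfolding has_exponential_moment_def by auto
  then have "integrable M (\<lambda>y. exp (\<eta> * \<bar>y\<bar>))"
    by (intro integrableI_nonneg) auto
  with \<eta>(1) show ?thesis by (rule that)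
qed

lemma (in real_distribution) integrable_of_exp_bound:
  fixes f :: "real \<Rightarrow> 'b::{banach, second_countable_topology}"
  assumes int: "integrable M (\<lambda>y. exp (\<eta> * \<bar>y\<bar>))"
    and [measurable]: "f \<in> borel_measurable borel"
    and f: "\<And>y. norm (f y) \<le> C * exp (c * \<bar>y\<bar>)" and "c \<le> \<eta>"
  shows "integrable M f"
proof (rule Bochner_Integration.integrable_bound)
  have C: "C \<ge> 0" using order_trans[OF norm_ge_zero f[of 0]] by simp
  show "integrable M (\<lambda>y. C * exp (\<eta> * \<bar>y\<bar>))" using int by simp
  have "norm (f y) \<le> norm (C * exp (\<eta> * \<bar>y\<bar>))" for y
  proof -
    have "C * exp (c * \<bar>y\<bar>) \<le> C * exp (\<eta> * \<bar>y\<bar>)"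
      using \<open>c \<le> \<eta>\<close> C by (intro mult_left_mono) (auto intro: mult_right_mono)
    then show ?thesis using f[of y] C by simp
  qed
  then show "AE y in M. norm (f y) \<le> norm (C * exp (\<eta> * \<bar>y\<bar>))" by simp
qed measurable

text \<open>Second-order Taylor expansion with Lagrange remainder. The available exponential
  \<open>exp (\<eta> * \<bar>y\<bar>)\<close> is split in two halves: one bounds the remainder's
  exponential, which requires \<open>s \<le> \<eta> / 2\<close>, and the other bounds
  \<open>y\<^sup>2 / 2\<close>.\<close>

lemma exp_minus_le_quadratic:
  fixes \<eta> s y :: real
  assumes "\<eta> > 0" "0 \<le> s" "s \<le> \<eta> / 2"
  shows "exp (- s * y) \<le> 1 - s * y + s\<^sup>2 * (4 / \<eta>\<^sup>2 * exp (\<eta> * \<bar>y\<bar>))"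
proof -
  obtain t where t: "\<bar>t\<bar> \<le> \<bar>- s * y\<bar>"
    "exp (- s * y) = (\<Sum>m<2. (- s * y) ^ m / fact m) + exp t / fact 2 * (- s * y)\<^sup>2"
    using Maclaurin_exp_le[of "- s * y" 2] by blast
  have "exp t \<le> exp (\<eta> / 2 * \<bar>y\<bar>)"
    using t(1) mult_right_mono[OF \<open>s \<le> \<eta> / 2\<close>, of "\<bar>y\<bar>"] \<open>0 \<le> s\<close> by (simp add: abs_mult)
  moreover have "y\<^sup>2 / 2 \<le> 4 / \<eta>\<^sup>2 * exp (\<eta> / 2 * \<bar>y\<bar>)"
  proof -
    have "(\<eta> / 2 * \<bar>y\<bar>)\<^sup>2 / 2 \<le> exp (\<eta> / 2 * \<bar>y\<bar>)"
      using exp_lower_Taylor_quadratic[of "\<eta> / 2 * \<bar>y\<bar>"] \<open>\<eta> > 0\<close>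
      by (smt (verit) divide_nonneg_pos mult_nonneg_nonneg zero_le_power2 abs_ge_zero)
    then show ?thesis using \<open>\<eta> > 0\<close> by (simp add: field_simps power2_eq_square)
  qed
  ultimately have "exp t * (y\<^sup>2 / 2) \<le> exp (\<eta> / 2 * \<bar>y\<bar>) * (4 / \<eta>\<^sup>2 * exp (\<eta> / 2 * \<bar>y\<bar>))"
    by (intro mult_mono) auto
  also have "\<dots> = 4 / \<eta>\<^sup>2 * (exp (\<eta> / 2 * \<bar>y\<bar>) * exp (\<eta> / 2 * \<bar>y\<bar>))" by simp
  also have "exp (\<eta> / 2 * \<bar>y\<bar>) * exp (\<eta> / 2 * \<bar>y\<bar>) = exp (\<eta> * \<bar>y\<bar>)"
    by (simp add: exp_add[symmetric])
  finally have "s\<^sup>2 * (exp t * (y\<^sup>2 / 2)) \<le> s\<^sup>2 * (4 / \<eta>\<^sup>2 * exp (\<eta> * \<bar>y\<bar>))"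
    by (intro mult_left_mono) auto
  then show ?thesis
    unfolding t(2) by (simp add: numeral_2_eq_2 power2_eq_square mult_ac)
qed

text \<open>To first order in \<open>s\<close> the integral is 1 minus \<open>s\<close> times the
  drift, so a positive drift pushes it below 1 for small \<open>s > 0\<close>.\<close>

lemma (in real_distribution) integral_exp_minus_less_1:
  assumes \<eta>: "\<eta> > 0" and int: "integrable M (\<lambda>y. exp (\<eta> * \<bar>y\<bar>))"
    and drift: "(LINT y|M. y) > 0" and \<delta>: "\<delta> > 0"
  obtains s where "0 < s" "s < \<delta>" "integrable M (\<lambda>y. exp (- s * y))" "(LINT y|M. exp (- s * y)) < 1"
proof -
  define A where "A = 4 / \<eta>\<^sup>2 * (LINT y|M. exp (\<eta> * \<bar>y\<bar>))"
  have A: "A \<ge> 0" unfolding A_def by (intro mult_nonneg_nonneg Bochner_Integration.integral_nonneg) auto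
  \<comment> \<open>The three bounds serve the quadratic estimate, the strict inequality
    \<open>s < \<delta>\<close>, and the domination of \<open>s\<^sup>2 * A\<close> by
    \<open>s\<close> times the drift; \<open>A + 1\<close> makes the last one strict.\<close>
  define s where "s = min (min (\<eta> / 2) (\<delta> / 2)) ((LINT y|M. y) / (A + 1))"
  have s: "0 < s" "s \<le> \<eta> / 2" "s < \<delta>"
    using assms A divide_pos_pos[OF drift, of "A + 1"] unfolding s_def by linarith+
  have "s \<le> (LINT y|M. y) / (A + 1)" by (simp add: s_def)
  then have s': "s * (A + 1) \<le> (LINT y|M. y)"
    using A by (simp add: pos_le_divide_eq)
  have int_id: "integrable M (\<lambda>y. y)"
  proof (rule integrable_of_exp_bound[OF int])
    show "norm y \<le> 1 / \<eta> * exp (\<eta> * \<bar>y\<bar>)" for y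
    proof -
      have "\<eta> * \<bar>y\<bar> \<le> exp (\<eta> * \<bar>y\<bar>)"
        using exp_ge_add_one_self[of "\<eta> * \<bar>y\<bar>"] by linarith
      then show ?thesis using \<eta> by (simp add: field_simps)
    qed
  qed auto
  have int_exp: "integrable M (\<lambda>y. exp (- s * y))"
  proof (rule integrable_of_exp_bound[OF int])
    show "norm (exp (- s * y)) \<le> 1 * exp (s * \<bar>y\<bar>)" for y
      using s abs_ge_minus_self[of "s * y"] by (simp add: abs_mult)
  qed (use s in auto)
  have "(LINT y|M. exp (- s * y)) \<le> (LINT y|M. 1 - s * y + s\<^sup>2 * (4 / \<eta>\<^sup>2 * exp (\<eta> * \<bar>y\<bar>)))"
    using int_exp int_id int exp_minus_le_quadratic[OF \<eta>, of s] s by (intro integral_mono) auto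
  also have "\<dots> = 1 - s * (LINT y|M. y) + s\<^sup>2 * A"
    using int_id int by (simp add: A_def)
  also have "\<dots> < 1"
  proof -
    have "s * (s * A) < s * (LINT y|M. y)"
      using s s' by (intro mult_strict_left_mono) (auto simp: algebra_simps)
    then show ?thesis by (simp add: power2_eq_square)
  qed
  finally show ?thesis using s int_exp that by blast
qed

text \<open>The exponential is expanded in powers of \<open>z\<close> and integrated termwise, with
  \<open>exp (norm z * \<bar>y\<bar>)\<close> dominating. The factor \<open>h\<close> is later a
  character \<open>exp (- \<i> * c * y)\<close>, so that every vertical translate of the Laplace
  transform is covered on the same disc.\<close>

lemma (in real_distribution) holomorphic_exp_transform:
  fixes h :: "real \<Rightarrow> complex"
  assumes int: "integrable M (\<lambda>y. exp (\<eta> * \<bar>y\<bar>))"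
    and [measurable]: "h \<in> borel_measurable borel" and h: "\<And>y. norm (h y) \<le> 1"
  shows "(\<lambda>z. LINT y|M. h y * exp (- z * of_real y)) holomorphic_on ball 0 \<eta>"
proof (rule power_series_holomorphic)
  fix z :: complex
  assume z: "z \<in> ball 0 \<eta>"
  let ?a = "\<lambda>n. LINT y|M. h y * (of_real (- y) ^ n / fact n)"
  define f where "f n y = h y * ((- z * of_real y) ^ n / fact n)" for n y
  have f_norm: "norm (f n y) \<le> (norm z * \<bar>y\<bar>) ^ n / fact n" for n y
    using mult_right_mono[OF h[of y], of "(norm z * \<bar>y\<bar>) ^ n / fact n"]
    by (simp add: f_def norm_mult norm_divide norm_power)
  have exp_sums: "(\<lambda>n. (norm z * \<bar>y\<bar>) ^ n / fact n) sums exp (norm z * \<bar>y\<bar>)" for y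
    using exp_converges[of "norm z * \<bar>y\<bar>"] by (simp add: field_simps)
  have partial_le: "(\<Sum>i<n. (norm z * \<bar>y\<bar>) ^ i / fact i) \<le> exp (norm z * \<bar>y\<bar>)" for n y
    using exp_sums[of y] sum_le_suminf[of "\<lambda>n. (norm z * \<bar>y\<bar>) ^ n / fact n" "{..<n}"]
    by (auto simp: sums_iff)
  have [measurable]: "f n \<in> borel_measurable borel" for n
    unfolding f_def by measurable
  have f_int: "integrable M (f n)" for n
  proof (rule integrable_of_exp_bound[OF int])
    show "norm (f n y) \<le> 1 * exp (norm z * \<bar>y\<bar>)" for y
    proof -
      have "(norm z * \<bar>y\<bar>) ^ n / fact n \<le> (\<Sum>i<Suc n. (norm z * \<bar>y\<bar>) ^ i / fact i)"
        by (simp add: sum_nonneg)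
      then show ?thesis using f_norm[of n y] partial_le[of y "Suc n"] by linarith
    qed
  qed (use z in auto)
  have exp_int: "integrable M (\<lambda>y. exp (norm z * \<bar>y\<bar>))"
    by (rule integrable_of_exp_bound[OF int, of _ 1 "norm z"]) (use z in auto)
  have "(\<lambda>n. LINT y|M. f n y) sums (LINT y|M. (\<Sum>n. f n y))"
  proof (rule sums_integral[OF f_int])
    have "summable (\<lambda>n. norm (f n y))" for y
      by (rule summable_comparison_test'[OF sums_summable[OF exp_sums[of y]], of 0])
        (simp add: f_norm)
    then show "AE y in M. summable (\<lambda>n. norm (f n y))" by simp
    \<comment> \<open>The partial sums are bounded by one integral, since the truncated exponential
      series lies below its sum.\<close>
    show "summable (\<lambda>n. LINT y|M. norm (f n y))"
    proof (rule summableI_nonneg_bounded)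
      show "(\<Sum>i<n. LINT y|M. norm (f i y)) \<le> (LINT y|M. exp (norm z * \<bar>y\<bar>))" for n
      proof -
        have "(\<Sum>i<n. norm (f i y)) \<le> exp (norm z * \<bar>y\<bar>)" for y
          using sum_mono[of "{..<n}" "\<lambda>i. norm (f i y)" "\<lambda>i. (norm z * \<bar>y\<bar>) ^ i / fact i"]
            f_norm partial_le[of y n] by force
        then have "(LINT y|M. (\<Sum>i<n. norm (f i y))) \<le> (LINT y|M. exp (norm z * \<bar>y\<bar>))"
          using f_int exp_int by (intro integral_mono) auto
        then show ?thesis using f_int by simp
      qed
    qed simp
  qed
  moreover have "(LINT y|M. f n y) = ?a n * (z - 0) ^ n" for n
  proof -
    have "f n = (\<lambda>y. h y * (of_real (- y) ^ n / fact n) * z ^ n)"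
      by (auto simp: f_def power_mult_distrib[symmetric] mult_ac)
    then show ?thesis by simp
  qed
  moreover have "(\<Sum>n. f n y) = h y * exp (- z * of_real y)" for y
  proof -
    have "(\<lambda>n. h y * ((- z * of_real y) ^ n / fact n)) sums (h y * exp (- z * of_real y))"
      using exp_converges[of "- z * of_real y"] by (intro sums_mult) (simp add: scaleR_conv_of_real divide_inverse mult.commute)
    then show ?thesis by (simp add: f_def sums_iff)
  qed
  ultimately show "(\<lambda>n. ?a n * (z - 0) ^ n) sums (LINT y|M. h y * exp (- z * of_real y))"
    by simp
qed

section \<open>Two-sided transforms on the line\<close>

lemma integrable_exp_minus_abs:
  fixes c :: real
  assumes "c > 0"
  shows "integrable lborel (\<lambda>x. exp (- c * \<bar>x\<bar>))"
proof (rule Bochner_Integration.integrable_bound)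
  let ?e = "\<lambda>x. indicator {0<..} x *\<^sub>R exp (- (x * c)) :: real"
  have e: "integrable lborel ?e"
    using integrable_I0i_exp_mscale[OF assms] by (simp add: set_integrable_def)
  show "integrable lborel (\<lambda>x. ?e x + ?e (0 + - 1 * x))"
    using e lborel_integrable_real_affine[OF e, of "-1" 0] by simp
  \<comment> \<open>At \<open>x = 0\<close> both one-sided functions vanish and the comparison
    fails, so the origin is removed as a null set.\<close>
  have "norm (exp (- c * \<bar>x\<bar>)) \<le> norm (?e x + ?e (0 + - 1 * x))" if "x \<noteq> 0" for x
    using that by (cases "x > 0") (auto simp: mult.commute)
  moreover have "AE x in lborel. x \<noteq> (0::real)"
    by (rule AE_lborel_singleton)
  ultimately show "AE x in lborel. norm (exp (- c * \<bar>x\<bar>)) \<le> norm (?e x + ?e (0 + - 1 * x))"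
    by (auto elim: eventually_mono)
qed measurable

text \<open>The two-sided Laplace transform turns \<open>u - P u\<close>, where \<open>P u x = \<integral> u (x + y) d\<rho>(y)\<close>,
  into the transform of \<open>u\<close> multiplied by \<open>1 - laplace_hat \<rho> z\<close>.\<close>

lemma (in real_distribution) transform_harmonic_defect_eq_0:
  fixes u f :: "real \<Rightarrow> real" and z :: complex
  assumes [measurable]: "u \<in> borel_measurable borel"
    and u: "\<And>x. \<bar>u x\<bar> \<le> K * exp (- \<gamma> * \<bar>x\<bar>)"
    and z: "\<bar>Re z\<bar> < \<gamma>" and int: "integrable M (\<lambda>y. exp (- Re z * y))"
    and f: "\<And>x. u x = f x + (LINT y|M. u (x + y))"
    and one: "laplace_hat M z = 1"
  shows "(LINT x|lborel. exp (z * of_real x) * of_real (f x)) = 0"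
proof -
  interpret pair_sigma_finite M lborel ..
  define v where "v x = exp (z * of_real x) * of_real (u x)" for x
  have [measurable]: "v \<in> borel_measurable borel" unfolding v_def by measurable
  have K: "K \<ge> 0" using u[of 0] by simp
  have v_int: "integrable lborel v"
  proof (rule Bochner_Integration.integrable_bound)
    show "integrable lborel (\<lambda>x. K * exp (- (\<gamma> - \<bar>Re z\<bar>) * \<bar>x\<bar>))"
      using integrable_exp_minus_abs[of "\<gamma> - \<bar>Re z\<bar>"] z by simp
    have "norm (v x) \<le> K * exp (- (\<gamma> - \<bar>Re z\<bar>) * \<bar>x\<bar>)" for x
    proof -
      have "norm (v x) = exp (Re z * x) * \<bar>u x\<bar>" by (simp add: v_def norm_mult)
      also have "\<dots> \<le> exp (\<bar>Re z\<bar> * \<bar>x\<bar>) * (K * exp (- \<gamma> * \<bar>x\<bar>))"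
        using u by (intro mult_mono) (auto simp: abs_mult[symmetric])
      also have "\<dots> = K * exp (- (\<gamma> - \<bar>Re z\<bar>) * \<bar>x\<bar>)"
        by (simp add: exp_add[symmetric] algebra_simps)
      finally show ?thesis .
    qed
    then show "AE x in lborel. norm (v x) \<le> norm (K * exp (- (\<gamma> - \<bar>Re z\<bar>) * \<bar>x\<bar>))"
      using K by simp
  qed measurable
  \<comment> \<open>Writing \<open>exp (z * x) * u (x + y)\<close> as a multiple of a translate of
    \<open>v\<close> makes Fubini applicable: by translation invariance the inner L1 norm is
    \<open>exp (- Re z * y)\<close> times that of \<open>v\<close>.\<close>
  define w where "w y x = exp (- z * of_real y) * v (y + x)" for y x
  have v_shift_int: "integrable lborel (\<lambda>x. v (y + x))" for y
    using lborel_integrable_real_affine[OF v_int, of 1 y] by simp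
  have v_shift: "(LINT x|lborel. v (y + x)) = (LINT x|lborel. v x)" for y
    using lborel_integral_real_affine[of 1 v y] by simp
  have norm_v_shift: "(LINT x|lborel. norm (v (y + x))) = (LINT x|lborel. norm (v x))" for y
    using lborel_integral_real_affine[of 1 "\<lambda>x. norm (v x)" y] by simp
  have w_int: "integrable (M \<Otimes>\<^sub>M lborel) (case_prod w)"
  proof (rule Fubini_integrable)
    show "integrable M (\<lambda>y. LINT x|lborel. norm (case_prod w (y, x)))"
      using int by (simp add: w_def norm_mult norm_v_shift)
    show "AE y in M. integrable lborel (\<lambda>x. case_prod w (y, x))"
      using v_shift_int by (simp add: w_def)
  qed (unfold w_def, measurable)
  have w_eq: "w y x = exp (z * of_real x) * of_real (u (x + y))" for x y
  proof -
    have "exp (- z * of_real y) * exp (z * of_real (y + x)) = exp (z * of_real x)"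
      by (simp add: exp_add[symmetric] algebra_simps)
    then show ?thesis
      unfolding w_def v_def by (simp only: mult.assoc[symmetric] add.commute[of x y])
  qed
  have Pu: "(LINT y|M. w y x) = exp (z * of_real x) * of_real (LINT y|M. u (x + y))" for x
    by (simp add: w_eq)
  have "(LINT x|lborel. exp (z * of_real x) * of_real (f x)) = (LINT x|lborel. v x - (LINT y|M. w y x))"
  proof (rule Bochner_Integration.integral_cong)
    fix x
    show "exp (z * of_real x) * of_real (f x) = v x - (LINT y|M. w y x)"
      unfolding Pu v_def using f[of x] by (simp add: algebra_simps)
  qed simp
  also have "\<dots> = (LINT x|lborel. v x) - (LINT x|lborel. LINT y|M. w y x)"
    using v_int integrable_snd[OF w_int] by simp
  also have "(LINT x|lborel. LINT y|M. w y x) = (LINT y|M. LINT x|lborel. w y x)"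
    by (rule Fubini_integral[OF w_int])
  also have "\<dots> = laplace_hat M z * (LINT x|lborel. v x)"
    by (simp add: w_def v_shift laplace_hat_def)
  finally show ?thesis by (simp add: one)
qed

section \<open>From a zero-free strip to the diophantine condition\<close>

text \<open>Cauchy-Schwarz is used in a pointwise weighted form. The square of
  \<open>exp (\<eta> / 2 * \<bar>y\<bar>)\<close> uses up the whole exponential moment, hence
  \<open>\<delta> \<le> \<eta> / 2\<close>; the other square integrates to
  \<open>Re (1 - laplace_hat M (\<i> * b))\<close>, at most \<open>\<epsilon>\<^sup>2\<close>, so
  the weight \<open>1 / \<epsilon>\<close> leaves a term of order \<open>\<epsilon>\<close>.\<close>

lemma (in real_distribution) laplace_hat_imaginary_shift:
  assumes int: "integrable M (\<lambda>y. exp (\<eta> * \<bar>y\<bar>))" and \<delta>: "\<delta> \<le> \<eta> / 2" and z: "norm z < \<delta>"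
    and \<epsilon>: "\<epsilon> > 0" and b: "norm (1 - laplace_hat M (\<i> * of_real b)) \<le> \<epsilon>\<^sup>2"
  shows "norm (laplace_hat M (\<i> * of_real b + z) - laplace_hat M z)
    \<le> \<epsilon> * ((LINT y|M. exp (\<eta> * \<bar>y\<bar>)) + 1)"
proof -
  let ?e = "\<lambda>y. exp (- (\<i> * of_real b) * of_real y)"
  have \<eta>: "\<eta> > 0" using \<delta> z norm_ge_zero[of z] by linarith
  have norm_e: "norm (?e y) = 1" for y by simp
  have int_e: "integrable M ?e"
    by (rule integrable_of_exp_bound[OF int, of _ 1 0]) (use \<eta> in auto)
  have norm_exp: "norm (exp (- z * of_real y)) \<le> exp (\<eta> / 2 * \<bar>y\<bar>)" for y
  proof -
    have "- Re z * y \<le> \<bar>Re z\<bar> * \<bar>y\<bar>"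
      using abs_ge_minus_self[of "Re z * y"] by (simp add: abs_mult)
    also have "\<dots> \<le> \<eta> / 2 * \<bar>y\<bar>"
      using abs_Re_le_cmod[of z] z \<delta> by (intro mult_right_mono) auto
    finally show ?thesis by simp
  qed
  have int_z: "integrable M (\<lambda>y. exp (- z * of_real y))"
    by (rule integrable_of_exp_bound[OF int, of _ 1 "\<eta> / 2"]) (use \<eta> norm_exp in auto)
  have int_z': "integrable M (\<lambda>y. ?e y * exp (- z * of_real y))"
    by (rule integrable_of_exp_bound[OF int, of _ 1 "\<eta> / 2"]) (use \<eta> norm_exp in \<open>auto simp: norm_mult\<close>)
  have sq: "(norm (?e y - 1))\<^sup>2 / 2 = Re (1 - ?e y)" for y
    unfolding cmod_power2 by (simp add: Re_exp Im_exp power2_eq_square algebra_simps diff_divide_distrib)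
  have pointwise: "norm (?e y * exp (- z * of_real y) - exp (- z * of_real y))
      \<le> \<epsilon> * exp (\<eta> * \<bar>y\<bar>) + 1 / \<epsilon> * Re (1 - ?e y)" for y
  proof -
    have "norm (?e y * exp (- z * of_real y) - exp (- z * of_real y))
        = norm (?e y - 1) * norm (exp (- z * of_real y))"
      unfolding norm_mult[symmetric] left_diff_distrib by simp
    also have "\<dots> \<le> norm (?e y - 1) * exp (\<eta> / 2 * \<bar>y\<bar>)"
      using norm_exp by (intro mult_left_mono) auto
    also have "\<dots> \<le> \<epsilon> * (exp (\<eta> / 2 * \<bar>y\<bar>))\<^sup>2 + 1 / \<epsilon> * ((norm (?e y - 1))\<^sup>2 / 2)"
    proof -
      have "q * p \<le> \<epsilon> * p\<^sup>2 + 1 / \<epsilon> * (q\<^sup>2 / 2)" for p q :: real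
      proof -
        have "2 * \<epsilon> * (q * p) \<le> 2 * \<epsilon>\<^sup>2 * p\<^sup>2 + q\<^sup>2"
          using zero_le_power2[of "\<epsilon> * p - q"] zero_le_power2[of "\<epsilon> * p"]
          unfolding power2_eq_square by (simp add: algebra_simps)
        also have "\<dots> = 2 * \<epsilon> * (\<epsilon> * p\<^sup>2 + 1 / \<epsilon> * (q\<^sup>2 / 2))"
          using \<epsilon> by (simp add: field_simps power2_eq_square)
        finally show ?thesis using \<epsilon> by simp
      qed
      then show ?thesis .
    qed
    also have "(exp (\<eta> / 2 * \<bar>y\<bar>))\<^sup>2 = exp (\<eta> * \<bar>y\<bar>)"
      by (simp add: power2_eq_square exp_add[symmetric])
    finally show ?thesis unfolding sq .
  qed
  have "laplace_hat M (\<i> * of_real b + z) - laplace_hat M z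
      = (LINT y|M. ?e y * exp (- z * of_real y) - exp (- z * of_real y))"
    using int_z int_z' by (simp add: laplace_hat_def exp_add[symmetric] algebra_simps)
  also have "norm \<dots> \<le> (LINT y|M. \<epsilon> * exp (\<eta> * \<bar>y\<bar>) + 1 / \<epsilon> * Re (1 - ?e y))"
    using int int_e int_z int_z' pointwise by (intro Bochner_Integration.integral_norm_bound_integral) auto
  also have "\<dots> = \<epsilon> * (LINT y|M. exp (\<eta> * \<bar>y\<bar>)) + 1 / \<epsilon> * Re (1 - laplace_hat M (\<i> * of_real b))"
  proof -
    have "(LINT y|M. Re (1 - ?e y)) = Re (LINT y|M. 1 - ?e y)"
      by (rule integral_Re) (use int_e in auto)
    also have "\<dots> = Re (1 - laplace_hat M (\<i> * of_real b))"
      using int_e by (simp add: laplace_hat_def)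
    finally have 1: "(LINT y|M. Re (1 - ?e y)) = Re (1 - laplace_hat M (\<i> * of_real b))" .
    have 2: "integrable M (\<lambda>y. Re (1 - ?e y))"
      by (rule integrable_Re) (use int_e in auto)
    show ?thesis
      using int 2 1 by simp
  qed
  also have "1 / \<epsilon> * Re (1 - laplace_hat M (\<i> * of_real b)) \<le> 1 / \<epsilon> * \<epsilon>\<^sup>2"
    using \<epsilon> b complex_Re_le_cmod[of "1 - laplace_hat M (\<i> * of_real b)"] by (intro mult_left_mono) auto
  finally show ?thesis using \<epsilon> by (simp add: power2_eq_square distrib_left)
qed

lemma (in real_distribution) weakly_diophantine_0I:
  assumes \<eta>: "\<eta> > 0" and int: "integrable M (\<lambda>y. exp (\<eta> * \<bar>y\<bar>))"
    and drift: "(LINT y|M. y) > 0" and \<delta>: "\<delta> > 0" "\<delta> \<le> \<eta> / 2"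
    and no_zero: "\<And>z. z \<noteq> 0 \<Longrightarrow> \<bar>Re z\<bar> < \<delta> \<Longrightarrow> laplace_hat M z \<noteq> 1"
  shows "weakly_diophantine_0 M"
proof (rule ccontr)
  let ?S = "ball (0::complex) \<delta>"
  let ?C = "(LINT y|M. exp (\<eta> * \<bar>y\<bar>)) + 1"
  assume contra: "\<not> weakly_diophantine_0 M"
  \<comment> \<open>The lower limit only sees large \<open>\<bar>b\<bar>\<close>, so
    \<open>\<bar>b\<bar> \<ge> \<delta>\<close> may be demanded; this keeps the origin out of the
    open disc of radius \<open>\<delta>\<close> about \<open>\<i> * b\<close>.\<close>
  have "\<exists>b. \<bar>b\<bar> \<ge> \<delta> \<and> norm (1 - laplace_hat M (\<i> * of_real b)) \<le> \<epsilon>" if "\<epsilon> > 0" for \<epsilon> :: real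
  proof (rule ccontr)
    assume "\<not> ?thesis"
    then have "\<forall>\<^sub>F b::real in at_infinity. ereal \<epsilon> \<le> ereal (norm (1 - laplace_hat M (\<i> * of_real b)))"
      by (intro eventually_at_infinityI[of \<delta>]) force
    then have "ereal \<epsilon> \<le> Liminf at_infinity (\<lambda>b::real. ereal (norm (1 - laplace_hat M (\<i> * of_real b))))"
      by (rule Liminf_bounded)
    moreover have "0 < ereal \<epsilon>" using that by simp
    ultimately have "weakly_diophantine_0 M"
      unfolding weakly_diophantine_0_def by (rule order_less_le_trans[rotated])
    with contra show False by contradiction
  qed
  \<comment> \<open>The square matches the \<open>\<epsilon>\<^sup>2\<close> in
    \<open>laplace_hat_imaginary_shift\<close>.\<close>
  then have "\<forall>n. \<exists>b. \<bar>b\<bar> \<ge> \<delta> \<and> norm (1 - laplace_hat M (\<i> * of_real b)) \<le> (inverse (real (Suc n)))\<^sup>2"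
    by simp
  then obtain b where b: "\<And>n. \<bar>b n\<bar> \<ge> \<delta>"
    "\<And>n. norm (1 - laplace_hat M (\<i> * of_real (b n))) \<le> (inverse (real (Suc n)))\<^sup>2"
    by metis
  have holo: "(\<lambda>z. 1 - laplace_hat M (\<i> * of_real c + z)) holomorphic_on ?S" for c
  proof -
    have "(\<lambda>z. LINT y|M. exp (- (\<i> * of_real c) * of_real y) * exp (- z * of_real y)) holomorphic_on ball 0 \<eta>"
      by (rule holomorphic_exp_transform[OF int]) auto
    moreover have "laplace_hat M (\<i> * of_real c + z) =
        (LINT y|M. exp (- (\<i> * of_real c) * of_real y) * exp (- z * of_real y))" for z
      by (simp add: laplace_hat_def exp_add[symmetric] algebra_simps)
    ultimately have "(\<lambda>z. laplace_hat M (\<i> * of_real c + z)) holomorphic_on ball 0 \<eta>" by simp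
    then show ?thesis
      using \<delta> \<eta> by (intro holomorphic_intros) (auto elim!: holomorphic_on_subset)
  qed
  \<comment> \<open>Hurwitz in contrapositive form: zero-free translates with a nonconstant limit
    force the limit to be zero-free, which contradicts \<open>laplace_hat M 0 = 1\<close>.\<close>
  have "1 - laplace_hat M 0 \<noteq> 0"
  proof (rule Hurwitz_no_zeros[of ?S "\<lambda>n z. 1 - laplace_hat M (\<i> * of_real (b n) + z)" "\<lambda>z. 1 - laplace_hat M z"])
    show "(\<lambda>z. 1 - laplace_hat M z) holomorphic_on ?S" using holo[of 0] by simp
    show "uniform_limit K (\<lambda>n z. 1 - laplace_hat M (\<i> * of_real (b n) + z)) (\<lambda>z. 1 - laplace_hat M z) sequentially"
      if K: "K \<subseteq> ?S" for K
    proof (rule uniform_limitI)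
      fix e :: real assume "e > 0"
      have "(\<lambda>n. inverse (real (Suc n)) * ?C) \<longlonglongrightarrow> 0 * ?C"
        by (intro tendsto_intros LIMSEQ_inverse_real_of_nat)
      then have "\<forall>\<^sub>F n in sequentially. inverse (real (Suc n)) * ?C < e"
        using \<open>e > 0\<close> by (intro order_tendstoD) auto
      then show "\<forall>\<^sub>F n in sequentially. \<forall>z\<in>K.
          dist (1 - laplace_hat M (\<i> * of_real (b n) + z)) (1 - laplace_hat M z) < e"
      proof eventually_elim
        case (elim n)
        show ?case
        proof
          fix z assume "z \<in> K"
          then have "norm z < \<delta>" using K by auto
          from laplace_hat_imaginary_shift[OF int \<delta>(2) this _ b(2)[of n]] elim
          show "dist (1 - laplace_hat M (\<i> * of_real (b n) + z)) (1 - laplace_hat M z) < e"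
            by (simp add: dist_norm norm_minus_commute)
        qed
      qed
    qed
    show "\<not> (\<lambda>z. 1 - laplace_hat M z) constant_on ?S"
    proof
      assume "(\<lambda>z. 1 - laplace_hat M z) constant_on ?S"
      then obtain c where c: "\<And>z. z \<in> ?S \<Longrightarrow> 1 - laplace_hat M z = c"
        by (auto simp: constant_on_def)
      have const: "laplace_hat M z = laplace_hat M 0" if "z \<in> ?S" for z
      proof -
        have "1 - laplace_hat M z = 1 - laplace_hat M 0"
          using c[OF that] c[of 0] \<delta>(1) by simp
        then show ?thesis by (simp only: diff_left_imp_eq)
      qed
      \<comment> \<open>Nonconstancy comes from the drift: at a small positive real point the
        transform is below its value 1 at the origin.\<close>
      obtain s where s: "0 < s" "s < \<delta>" "(LINT y|M. exp (- s * y)) < 1"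
        using integral_exp_minus_less_1[OF \<eta> int drift \<delta>(1)] by blast
      have "laplace_hat M (of_real s) = of_real (LINT y|M. exp (- s * y))"
        unfolding laplace_hat_def by (subst integral_complex_of_real[symmetric]) (simp add: exp_of_real[symmetric])
      moreover have "laplace_hat M 0 = 1" by (simp add: laplace_hat_def)
      ultimately show False using const[of "of_real s"] s by (simp del: of_real_1 add: of_real_1[symmetric, where 'a=complex])
    qed
    show "1 - laplace_hat M (\<i> * of_real (b n) + z) \<noteq> 0" if z: "z \<in> ?S" for n z
    proof -
      have "\<i> * of_real (b n) + z \<noteq> 0"
      proof
        assume "\<i> * of_real (b n) + z = 0"
        then have "z = - (\<i> * of_real (b n))" by (simp add: eq_neg_iff_add_eq_0 add.commute)
        with z b(1)[of n] show False by (simp add: norm_mult)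
      qed
      moreover have "\<bar>Re (\<i> * of_real (b n) + z)\<bar> < \<delta>"
        using z abs_Re_le_cmod[of z] by simp
      ultimately show ?thesis using no_zero by force
    qed
  qed (use \<delta> holo in auto)
  then show False by (simp add: laplace_hat_def)
qed

subsection \<open>A zero-free strip\<close>

lemma integrable_lborel_compact_support:
  fixes h :: "real \<Rightarrow> 'a::euclidean_space"
  assumes "continuous_on UNIV h" and "\<And>x. \<bar>x\<bar> \<ge> b \<Longrightarrow> h x = 0"
  shows "integrable lborel h"
proof -
  have "integrable lborel (\<lambda>x. indicator {-b..b} x *\<^sub>R h x)"
    using borel_integrable_atLeastAtMost'[of "-b" b h] assms(1)
    by (auto simp: set_integrable_def intro: continuous_on_subset)
  moreover have "(\<lambda>x. indicator {-b..b} x *\<^sub>R h x) = h"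
    using assms(2) by (auto simp: indicator_def fun_eq_iff)
  ultimately show ?thesis by simp
qed

lemma integral_derivative_compact_support:
  fixes F :: "real \<Rightarrow> 'a::euclidean_space"
  assumes F: "\<And>x. (F has_vector_derivative F' x) (at x)" and F': "continuous_on UNIV F'"
    and supp: "\<And>x. \<bar>x\<bar> \<ge> b \<Longrightarrow> F x = 0" "\<And>x. \<bar>x\<bar> \<ge> b \<Longrightarrow> F' x = 0" and "b > 0"
  shows "(LINT x|lborel. F' x) = 0"
proof -
  have "(LINT x|lborel. indicator {-b..b} x *\<^sub>R F' x) = F b - F (- b)"
    using F' \<open>b > 0\<close>
    by (intro integral_FTC_atLeastAtMost has_vector_derivative_at_within[OF F])
      (auto intro: continuous_on_subset)
  moreover have "(\<lambda>x. indicator {-b..b} x *\<^sub>R F' x) = F'"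
    using supp(2) by (auto simp: indicator_def fun_eq_iff)
  ultimately show ?thesis using supp(1) \<open>b > 0\<close> by simp
qed

text \<open>Up to the factor \<open>1 / lam\<close>, the convolution is the integral of
  \<open>f\<close> over \<open>{x..}\<close>. For \<open>\<bar>x\<bar> \<ge> b\<close> this ray
  misses every point where \<open>f\<close> is nonzero or contains them all, and the full integral
  is zero.\<close>

lemma conv_fun_T_measure_eq_0:
  assumes f: "continuous_on UNIV f" and supp: "\<And>x. \<bar>x\<bar> \<ge> b \<Longrightarrow> f x = 0"
    and zero: "(LINT x|lborel. f x) = 0" and x: "\<bar>x\<bar> \<ge> b" and "lam > 0"
  shows "conv_fun (T_measure lam) f x = 0"
proof -
  have [measurable]: "f \<in> borel_measurable borel"
    using f by (rule borel_measurable_continuous_onI)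
  have "conv_fun (T_measure lam) f x = (LINT y|lborel. 1 / lam * indicator {..0} y * f (x - y))"
    unfolding conv_fun_def T_measure_def using \<open>lam > 0\<close>
    by (subst integral_real_density) auto
  also have "\<dots> = (LINT y|lborel. 1 / lam * indicator {x..} y * f y)"
    using lborel_integral_real_affine[of "-1" "\<lambda>y. 1 / lam * indicator {..0} y * f (x - y)" x]
    by (simp add: indicator_def)
  also have "\<dots> = (LINT y|lborel. (if x > 0 then 0 else 1 / lam) * f y)"
  proof (rule Bochner_Integration.integral_cong)
    fix y
    show "1 / lam * indicator {x..} y * f y = (if x > 0 then 0 else 1 / lam) * f y"
      using supp[of y] x by (cases "f y = 0") (auto simp: indicator_def)
  qed simp
  also have "\<dots> = 0" using zero by simp
  finally show ?thesis .
qed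

lemma bump_transform_nonzero:
  fixes z :: complex
  obtains g where "smooth_compact_support g" "(LINT x|lborel. exp (z * of_real x) * of_real (g x)) \<noteq> 0"
proof -
  \<comment> \<open>On \<open>\<bar>x\<bar> < a\<close> the phase \<open>Im z * x\<close> stays
    below 1 in absolute value, so its cosine is positive and the integrand has positive real
    part.\<close>
  define a where "a = 1 / (\<bar>Im z\<bar> + 1)"
  have a: "a > 0" by (simp add: a_def)
  obtain g where g: "smooth_compact_support g" "\<And>x. g x \<ge> 0" "\<And>x. g x > 0 \<longleftrightarrow> \<bar>x\<bar> < a"
    using exists_bump[OF a] by blast
  have supp: "g x = 0" if "\<bar>x\<bar> \<ge> a" for x
    using g(2,3)[of x] that by linarith
  have cont: "continuous_on UNIV g"
    using g(1) by (rule smooth_compact_support_continuous)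
  let ?h = "\<lambda>x. exp (z * of_real x) * of_real (g x)"
  have int: "integrable lborel ?h"
    using cont supp by (intro integrable_lborel_compact_support[of _ a] continuous_intros) auto
  have cos: "cos (Im z * x) > 0" if "\<bar>x\<bar> < a" for x
  proof -
    have "\<bar>Im z * x\<bar> \<le> (\<bar>Im z\<bar> + 1) * \<bar>x\<bar>" by (simp add: abs_mult distrib_right)
    also have "\<dots> < (\<bar>Im z\<bar> + 1) * a" using that by (intro mult_strict_left_mono) auto
    also have "\<dots> = 1" by (simp add: a_def)
    finally have "\<bar>Im z * x\<bar> < 1" .
    then show ?thesis using pi_gt3 by (intro cos_gt_zero_pi) auto
  qed
  have Re: "Re (?h x) = exp (Re z * x) * cos (Im z * x) * g x" for x
    by (simp add: Re_exp)
  have nonneg: "Re (?h x) \<ge> 0" for x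
    unfolding Re using cos[of x] g(2)[of x] supp[of x] by (cases "\<bar>x\<bar> < a") auto
  have pos: "Re (?h x) > 0" if "\<bar>x\<bar> < a" for x
    unfolding Re using cos[OF that] g(3)[of x] that by simp
  have "(LINT x|lborel. ?h x) \<noteq> 0"
  proof
    assume "(LINT x|lborel. ?h x) = 0"
    then have "(LINT x|lborel. Re (?h x)) = 0"
      using integral_Re[OF int] by simp
    then have "AE x in lborel. Re (?h x) = 0"
      using integral_nonneg_eq_0_iff_AE[of lborel "\<lambda>x. Re (?h x)"] integrable_Re[OF int] nonneg by auto
    then have "AE x in lborel. x \<notin> {-a<..<a}"
    proof eventually_elim
      case (elim x)
      show ?case
      proof
        assume "x \<in> {-a<..<a}"
        then have "\<bar>x\<bar> < a" by auto
        from pos[OF this] elim show False by linarith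
      qed
    qed
    then have "{-a<..<a} \<in> null_sets lborel"
      by (subst (asm) AE_iff_null_sets[symmetric]) auto
    then show False using a by (simp add: null_sets_def)
  qed
  with g(1) show ?thesis by (rule that)
qed

lemma exp_decay_everywhere:
  fixes u :: "real \<Rightarrow> real"
  assumes "u \<in> O[at_infinity](\<lambda>x. exp (- \<gamma> * \<bar>x\<bar>))" and u: "\<And>x. \<bar>u x\<bar> \<le> K * exp (- s * x)"
    and "\<gamma> > 0" "s > 0"
  obtains C where "\<And>x. \<bar>u x\<bar> \<le> C * exp (- \<gamma> * \<bar>x\<bar>)"
proof -
  obtain c where "c > 0" "\<forall>\<^sub>F x in at_infinity. norm (u x) \<le> c * norm (exp (- \<gamma> * \<bar>x\<bar>))"
    using assms(1) by (auto elim: landau_o.bigE)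
  then obtain R where R: "\<And>x. \<bar>x\<bar> \<ge> R \<Longrightarrow> \<bar>u x\<bar> \<le> c * exp (- \<gamma> * \<bar>x\<bar>)"
    by (auto simp: eventually_at_infinity)
  have K: "K \<ge> 0" using u[of 0] by simp
  show ?thesis
  proof (rule that)
    fix x
    \<comment> \<open>The asymptotic bound covers \<open>\<bar>x\<bar> \<ge> R\<close>. For smaller
      \<open>\<bar>x\<bar>\<close> the global bound \<open>K * exp (- s * x)\<close> applies, at the
      cost of the factor \<open>exp ((s + \<gamma>) * R)\<close>.\<close>
    let ?C = "max c (K * exp ((s + \<gamma>) * R))"
    show "\<bar>u x\<bar> \<le> ?C * exp (- \<gamma> * \<bar>x\<bar>)"
    proof (cases "\<bar>x\<bar> \<ge> R")
      case True
      then show ?thesis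
        by (intro order_trans[OF R[OF True] mult_right_mono]) auto
    next
      case False
      have "- s * x \<le> s * \<bar>x\<bar>" using \<open>s > 0\<close> abs_ge_minus_self[of "s * x"] by (simp add: abs_mult)
      moreover have "(s + \<gamma>) * \<bar>x\<bar> \<le> (s + \<gamma>) * R"
        using False assms(3,4) by (intro mult_left_mono) auto
      ultimately have "exp (- s * x) \<le> exp ((s + \<gamma>) * R + - \<gamma> * \<bar>x\<bar>)"
        by (simp add: algebra_simps)
      then have "K * exp (- s * x) \<le> K * exp ((s + \<gamma>) * R) * exp (- \<gamma> * \<bar>x\<bar>)"
        using K unfolding exp_add mult.assoc by (intro mult_left_mono) auto
      also have "\<dots> \<le> ?C * exp (- \<gamma> * \<bar>x\<bar>)" by (intro mult_right_mono) auto
      finally show ?thesis using u[of x] by linarith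
    qed
  qed
qed

lemma exp_dominates_compact_support:
  fixes f :: "real \<Rightarrow> real"
  assumes f: "continuous_on UNIV f" and supp: "\<And>x. \<bar>x\<bar> \<ge> b \<Longrightarrow> f x = 0"
  obtains C where "\<And>x. \<bar>f x\<bar> \<le> C * exp (- s * x)"
proof -
  have "compact ((\<lambda>x. f x * exp (s * x)) ` {-b..b})"
    using f by (intro compact_continuous_image continuous_intros) (auto intro: continuous_on_subset)
  then obtain C where "C > 0" and C: "\<forall>x\<in>{-b..b}. \<bar>f x * exp (s * x)\<bar> \<le> C"
    by (auto dest!: compact_imp_bounded simp: bounded_pos)
  have "\<bar>f x\<bar> \<le> C * exp (- s * x)" for x
  proof (cases "\<bar>x\<bar> \<le> b")
    case True
    then have "\<bar>f x * exp (s * x)\<bar> \<le> C" by (intro C[rule_format]) auto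
    then show ?thesis by (simp add: abs_mult exp_minus field_simps)
  qed (use supp[of x] \<open>C > 0\<close> in auto)
  then show ?thesis by (rule that)
qed

lemma (in real_distribution) laplace_hat_neq_1:
  assumes int: "integrable M (\<lambda>y. exp (\<eta> * \<bar>y\<bar>))" and \<eta>: "\<eta> > 0"
    and drift: "(LINT y|M. y) > 0" and lam: "lam > 0" and \<gamma>: "\<gamma> > 0"
    and decay: "\<And>f. smooth_compact_support f \<Longrightarrow>
      (\<lambda>x. conv_fun (green_measure M) f x - conv_fun (T_measure lam) f x)
        \<in> O[at_infinity](\<lambda>x. exp (- \<gamma> * \<bar>x\<bar>))"
    and z: "z \<noteq> 0" "\<bar>Re z\<bar> < \<gamma>" "\<bar>Re z\<bar> \<le> \<eta>"
  shows "laplace_hat M z \<noteq> 1"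
proof
  assume one: "laplace_hat M z = 1"
  have M: "real_distribution M" by unfold_locales
  obtain g where g: "smooth_compact_support g"
    "(LINT x|lborel. exp (z * of_real x) * of_real (g x)) \<noteq> 0"
    by (rule bump_transform_nonzero)
  \<comment> \<open>A derivative of a compactly supported function has integral zero, which makes
    the \<open>T_measure\<close> term vanish outside a bounded interval.\<close>
  define f where "f = deriv g"
  have f: "smooth_compact_support f"
    unfolding f_def using g(1) by (rule smooth_compact_support_deriv)
  obtain b1 where b1: "b1 > 0" "\<And>x. \<bar>x\<bar> \<ge> b1 \<Longrightarrow> g x = 0"
    using smooth_compact_support_bounded_support[OF g(1)] by blast
  obtain b2 where b2: "b2 > 0" "\<And>x. \<bar>x\<bar> \<ge> b2 \<Longrightarrow> f x = 0"
    using smooth_compact_support_bounded_support[OF f] by blast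
  define b where "b = max b1 b2"
  have b: "b > 0" "\<And>x. \<bar>x\<bar> \<ge> b \<Longrightarrow> g x = 0" "\<And>x. \<bar>x\<bar> \<ge> b \<Longrightarrow> f x = 0"
    using b1 b2 by (auto simp: b_def)
  have deriv_g: "(g has_vector_derivative f x) (at x)" for x
    unfolding f_def has_real_derivative_iff_has_vector_derivative[symmetric]
    using g(1) by (rule smooth_compact_support_has_deriv)
  have cont: "continuous_on UNIV g" "continuous_on UNIV f"
    using g(1) f by (auto intro: smooth_compact_support_continuous)
  have int_f: "(LINT x|lborel. f x) = 0"
    using integral_derivative_compact_support[OF deriv_g cont(2) b(2,3,1)] by simp
  obtain s where s: "0 < s" "integrable M (\<lambda>y. exp (- s * y))" "(LINT y|M. exp (- s * y)) < 1"
    using integral_exp_minus_less_1[OF \<eta> int drift \<eta>] by blast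
  obtain C where C: "\<And>x. \<bar>f x\<bar> \<le> C * exp (- s * x)"
    using exp_dominates_compact_support[OF cont(2) b(3), where s = s] by blast
  have f_borel: "f \<in> borel_measurable borel"
    using cont(2) by (rule borel_measurable_continuous_onI)
  define u where "u = conv_fun (green_measure M) f"
  note green = conv_fun_green_measure[OF M s(2,3) f_borel C, folded u_def]
  obtain K where K: "\<And>x. \<bar>u x\<bar> \<le> K * exp (- s * x)" using green(2) by blast
  \<comment> \<open>For \<open>\<bar>x\<bar> \<ge> b\<close> the error term is \<open>u\<close>
    itself, so the assumed decay passes to \<open>u\<close>.\<close>
  have "u \<in> O[at_infinity](\<lambda>x. exp (- \<gamma> * \<bar>x\<bar>))"
  proof (rule landau_o.big.in_cong[THEN iffD1, OF _ decay[OF f, folded u_def]])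
    show "\<forall>\<^sub>F x in at_infinity. u x - conv_fun (T_measure lam) f x = u x"
      using conv_fun_T_measure_eq_0[OF cont(2) b(3) int_f _ lam]
      by (intro eventually_at_infinityI[of b]) simp
  qed
  from exp_decay_everywhere[OF this K \<gamma> s(1)]
  obtain K' where K': "\<And>x. \<bar>u x\<bar> \<le> K' * exp (- \<gamma> * \<bar>x\<bar>)" by blast
  have "integrable M (\<lambda>y. exp (- Re z * y))"
  proof (rule integrable_of_exp_bound[OF int])
    show "norm (exp (- Re z * y)) \<le> 1 * exp (\<bar>Re z\<bar> * \<bar>y\<bar>)" for y
      using abs_ge_minus_self[of "Re z * y"] by (simp add: abs_mult)
  qed (use z(3) in auto)
  from transform_harmonic_defect_eq_0[OF green(1) K' z(2) this green(3) one]
  have transform_f: "(LINT x|lborel. exp (z * of_real x) * of_real (f x)) = 0" .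
  have int_zg: "integrable lborel (\<lambda>x. exp (z * of_real x) * of_real (g x))"
    using cont b by (intro integrable_lborel_compact_support[of _ b] continuous_intros) auto
  have int_zf: "integrable lborel (\<lambda>x. exp (z * of_real x) * of_real (f x))"
    using cont b by (intro integrable_lborel_compact_support[of _ b] continuous_intros) auto
  \<comment> \<open>Integration by parts: the transform of \<open>f\<close> is \<open>- z\<close>
    times that of \<open>g\<close>. The former is zero while \<open>z\<close> and the latter are
    not.\<close>
  have "(LINT x|lborel. z * (exp (z * of_real x) * of_real (g x)) + exp (z * of_real x) * of_real (f x)) = 0"
  proof (rule integral_derivative_compact_support)
    show "((\<lambda>x. exp (z * of_real x) * of_real (g x)) has_vector_derivative
        z * (exp (z * of_real x) * of_real (g x)) + exp (z * of_real x) * of_real (f x)) (at x)" for x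
    proof -
      have "((\<lambda>w. exp (z * w)) has_field_derivative exp (z * of_real x) * z) (at (of_real x))"
        by (auto intro!: derivative_eq_intros)
      from has_vector_derivative_real_field[OF this]
      have 1: "((\<lambda>x. exp (z * of_real x)) has_vector_derivative exp (z * of_real x) * z) (at x)" .
      have 2: "((\<lambda>x. complex_of_real (g x)) has_vector_derivative of_real (f x)) (at x)"
        using bounded_linear.has_vector_derivative[OF bounded_linear_of_real deriv_g] .
      show ?thesis
        by (rule has_vector_derivative_eq_rhs[OF has_vector_derivative_mult[OF 1 2]]) (simp add: algebra_simps)
    qed
    show "continuous_on UNIV (\<lambda>x. z * (exp (z * of_real x) * of_real (g x)) + exp (z * of_real x) * of_real (f x))"
      using cont by (intro continuous_intros)
  qed (use b in auto)
  then show False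
    using int_zg int_zf transform_f g(2) z(1) by simp
qed

theorem proposition4p7:
  fixes \<rho> :: "real measure" and lam \<gamma> :: real
  assumes "real_distribution \<rho>"
    and "has_exponential_moment \<rho>"
    and "lam = (LINT y|\<rho>. y)" and "lam > 0"
    and "\<gamma> > 0"
    and "\<And>f. smooth_compact_support f \<Longrightarrow>
      (\<lambda>x. conv_fun (green_measure \<rho>) f x - conv_fun (T_measure lam) f x)
        \<in> O[at_infinity](\<lambda>x. exp (- \<gamma> * \<bar>x\<bar>))"
  shows "weakly_diophantine_0 \<rho>"
proof -
  interpret real_distribution \<rho> by fact
  obtain \<eta> where \<eta>: "\<eta> > 0" and int: "integrable \<rho> (\<lambda>y. exp (\<eta> * \<bar>y\<bar>))"
    using has_exponential_momentE[OF assms(2)] by blast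
  have drift: "(LINT y|\<rho>. y) > 0" using assms(3,4) by simp
  show ?thesis
  proof (rule weakly_diophantine_0I[OF \<eta> int drift])
    \<comment> \<open>The width \<open>\<gamma>\<close> is where the decay excludes zeros;
      \<open>\<eta> / 2\<close> is what \<open>laplace_hat_imaginary_shift\<close> allows.\<close>
    show "min \<gamma> (\<eta> / 2) > 0" "min \<gamma> (\<eta> / 2) \<le> \<eta> / 2" using \<eta> assms(5) by auto
    show "laplace_hat \<rho> z \<noteq> 1" if "z \<noteq> 0" "\<bar>Re z\<bar> < min \<gamma> (\<eta> / 2)" for z
      by (rule laplace_hat_neq_1[OF int \<eta> drift assms(4-6)]) (use that \<eta> in auto)
  qed
qed

end
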